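(* Let $n\in\mathbb{N}$ and let $g:\mathbb{R}^n\to\mathbb{R}$ be Borel measurable and satisfy (i) $0\le x_i\le y_i$ for $i=1,\dots,n$ implies $g(x_1,\dots,x_n)\le g(y_1,\dots,y_n)$; (ii) for all $(x_1,\dots,x_n)\in\mathbb{R}^n$, $g(x_1,\dots,x_n)\le g(|x_1|,\dots,|x_n|)$. Let $f=(f_1,\dots,f_n)\in\mathcal{B}^n$ be an $n$-tuple of absolute tail bounds, and let $\widetilde{X}=(\widetilde{X}_1,\dots,\widetilde{X}_n):(0,1)^n\to\mathbb{R}^n$, $\widetilde X(s_1,\dots,s_n)=(\widetilde X_1(s_1),\dots,\widetilde X_n(s_n))$, where $\widetilde{X}_k(s)=\sup f_k^{-1}[1-s,1]$ for $s\in(0,1)$. Then $$\sup_{X\in\mathcal{T}(f)}P(g(X)\ge t)=P(g(\widetilde{X})\ge t)\qquad\text{for all }t\in\mathbb{R}.$$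
   Context: All sets carry the Borel $\sigma$-algebra; $(0,1)^n$ carries Lebesgue measure, which is the probability measure $P$ for random variables with domain $(0,1)^n$. A real random variable is neat if it is a monotonically increasing (nondecreasing) function $X:(0,1)\to\mathbb{R}$; $\mathcal{N}$ is the set of neat random variables. $\mathcal{N}^n$ is the set of product random variables $X=(X_1,\dots,X_n):(0,1)^n\to\mathbb{R}^n$, $X(s_1,\dots,s_n)=(X_1(s_1),\dots,X_n(s_n))$, with $X_1,\dots,X_n\in\mathcal{N}$ (so the components are mutually independent). $\mathcal{B}$ is the set of functions $f:[0,\infty)\to[0,1]$ with $f(0)=1$, $f$ monotonically decreasing (nonincreasing) with limit $0$ at $\infty$, and $f$ left continuous. Whenever needed, such $f$ is extended to $\mathbb{R}$ by $f(t)=1$ for $t<0$. For $f=(f_1,\dots,f_n)\in\mathcal{B}^n$, $\mathcal{T}(f)=\{X\in\mathcal{N}^n : P(|X_k|\ge t)\le f_k(t)\ \forall t\ge0,\ k=1,\dots,n\}$. *)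

theory Defs
  imports "HOL-Analysis.Analysis"
begin

text \<open>The probability space \<open>(0,1)\<^sup>n\<close> with the Borel sets and Lebesgue measure. At type \<^typ>\<open>real\<close>
  this is the interval \<open>(0,1)\<close>, at type \<^typ>\<open>real^'n\<close> the open unit cube.\<close>

definition unit_cube :: "'a::euclidean_space measure" where
  "unit_cube = restrict_space lborel (box 0 One)"

text \<open>Functions on \<open>(0,1)\<close> or \<open>[0,\<infinity>)\<close> are represented by total functions on \<^typ>\<open>real\<close>, of which only
  the values on the intended domain are ever used.\<close>

definition neat :: "(real \<Rightarrow> real) set" where
  "neat = {X. mono_on {0<..<1} X}"

definition product_rv :: "('n::finite \<Rightarrow> real \<Rightarrow> real) \<Rightarrow> real^'n \<Rightarrow> real^'n" where
  "product_rv X s = (\<chi> k. X k (s $ k))"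

text \<open>Left continuity is only a condition at \<open>t > 0\<close>, since the domain is \<open>[0,\<infinity>)\<close> (and the
  extension by \<open>1\<close> to negative arguments is left continuous at \<open>0\<close>).\<close>

definition tail_bounds :: "(real \<Rightarrow> real) set" where
  "tail_bounds = {f. f \<in> {0..} \<rightarrow> {0..1} \<and> f 0 = 1 \<and> antimono_on {0..} f \<and>
     (f \<longlongrightarrow> 0) at_top \<and> (\<forall>t>0. continuous (at_left t) f)}"

definition tail_bounded :: "('n::finite \<Rightarrow> real \<Rightarrow> real) \<Rightarrow> (real^'n \<Rightarrow> real^'n) set" where
  "tail_bounded f = {product_rv X | X. \<forall>k. X k \<in> neat \<and>
     (\<forall>t\<ge>0. measure unit_cube {s \<in> space unit_cube. \<bar>X k s\<bar> \<ge> t} \<le> f k t)}"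

text \<open>For \<open>s \<in> (0,1)\<close>, the supremum of the preimage of \<open>[1-s,1]\<close> under \<open>f : [0,\<infinity>) \<rightarrow> [0,1]\<close>. This set is
  nonempty and bounded above for \<open>f \<in> tail_bounds\<close>.\<close>

definition extremal_rv :: "(real \<Rightarrow> real) \<Rightarrow> real \<Rightarrow> real" where
  "extremal_rv f s = Sup (f -` {1 - s..1} \<inter> {0..})"

end

theory Submission
  imports Defs "HOL-Probability.Distribution_Functions"
begin

text \<open>If \<open>Y\<^sub>k = |X\<^sub>k|\<close> has tail function \<open>h\<^sub>k \<le> f\<^sub>k\<close>, then the quantile transform \<open>Z\<^sub>k\<close> of
  \<open>h\<^sub>k\<close> has the law of \<open>Y\<^sub>k\<close> and lies pointwise below the quantile transform \<open>E\<^sub>k\<close> of \<open>f\<^sub>k\<close>, because the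
  transform is monotone in the tail function. On a product space the law of the vector
  is determined by the laws of the components, so \<open>g(Y)\<close> and \<open>g(Z)\<close> have equal laws and
  \<open>P(g(X) \<ge> t) \<le> P(g(Y) \<ge> t) = P(g(Z) \<ge> t) \<le> P(g(E) \<ge> t)\<close>. The bound is attained, since the extremal
  variables themselves have tail functions \<open>f\<^sub>k\<close>.\<close>

section \<open>The unit cube as a product probability space\<close>

lemma space_unit_cube [simp]: "space unit_cube = box 0 One"
  by (simp add: unit_cube_def space_restrict_space)

lemma sets_unit_cube: "sets unit_cube = sets (restrict_space borel (box 0 One))"
  unfolding unit_cube_def by (rule sets_restrict_space_cong) simp

lemma measurable_unit_cube_eq:
  "measurable unit_cube M = measurable (restrict_space borel (box 0 One)) M"
  by (rule measurable_cong_sets) (simp_all add: sets_unit_cube)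

lemma emeasure_unit_cube:
  "A \<subseteq> box 0 One \<Longrightarrow> emeasure unit_cube A = emeasure lborel A"
  unfolding unit_cube_def by (rule emeasure_restrict_space) auto

lemma prob_space_unit_cube: "prob_space (unit_cube :: 'a::euclidean_space measure)"
proof
  show "emeasure (unit_cube :: 'a measure) (space unit_cube) = 1"
    by (simp add: emeasure_unit_cube emeasure_lborel_box_eq)
qed

interpretation cube: prob_space "unit_cube :: 'a::euclidean_space measure"
  by (rule prob_space_unit_cube)

text \<open>As a simp rule this turns membership in \<open>box 0 One\<close> into the coordinatewise
  condition \<open>s $ k \<in> {0<..<1}\<close>.\<close>

lemma sum_Basis_vec_nth [simp]: "(\<Sum>b\<in>Basis. (b :: real^'n) $ k) = 1"
proof -
  have "(\<Sum>b\<in>Basis. (b :: real^'n) $ k) = (One :: real^'n) \<bullet> axis k 1"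
    by (simp add: inner_axis)
  also have "\<dots> = 1"
    by (rule inner_sum_Basis) (simp add: axis_in_Basis_iff)
  finally show ?thesis .
qed

lemma mem_unit_cube_vec: "s \<in> box 0 (One :: real^'n) \<longleftrightarrow> (\<forall>k. s $ k \<in> {0<..<1})"
  by (simp add: mem_box_cart)

lemma measurable_vec_lambda:
  fixes Y :: "'a \<Rightarrow> 'n::finite \<Rightarrow> real"
  assumes "\<And>k. (\<lambda>x. Y x k) \<in> borel_measurable M"
  shows "(\<lambda>x. \<chi> k. Y x k) \<in> borel_measurable M"
proof (subst borel_measurable_euclidean_space, rule ballI)
  fix i :: "real^'n" assume "i \<in> Basis"
  then obtain k where "i = axis k 1" by (auto simp: Basis_vec_def)
  then show "(\<lambda>x. (\<chi> k. Y x k) \<bullet> i) \<in> borel_measurable M"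
    using assms by (simp add: inner_axis)
qed

text \<open>Lebesgue measure is determined by its values on boxes, and the preimage of a box is a
  product of intervals. This carries the product formula \<open>emeasure_PiM\<close> over to
  vectors.\<close>

lemma lborel_vec_eq: "distr (\<Pi>\<^sub>M k\<in>UNIV. lborel) borel (\<lambda>x. \<chi> k. x k) = (lborel :: (real^'n) measure)"
proof (rule lborel_eqI[symmetric])
  interpret product_sigma_finite "\<lambda>k::'n. lborel :: real measure" ..
  fix l u :: "real^'n" assume le: "\<And>b. b \<in> Basis \<Longrightarrow> l \<bullet> b \<le> u \<bullet> b"
  have le': "l $ k \<le> u $ k" for k
    using le[of "axis k 1"] by (simp add: inner_axis axis_in_Basis_iff)
  have [measurable]: "(\<lambda>x. \<chi> k. x k) \<in> (\<Pi>\<^sub>M k\<in>UNIV. lborel) \<rightarrow>\<^sub>M (borel :: (real^'n) measure)"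
    by (rule measurable_vec_lambda) simp
  have "(\<lambda>x. \<chi> k. x k) -` box l u \<inter> space (\<Pi>\<^sub>M k\<in>UNIV. lborel) = (\<Pi>\<^sub>E k\<in>UNIV. {l $ k<..<u $ k})"
    by (auto simp: mem_box_cart space_PiM PiE_iff Pi_iff)
  then have "emeasure (distr (\<Pi>\<^sub>M k\<in>UNIV. lborel) borel (\<lambda>x. \<chi> k. x k)) (box l u)
      = (\<Prod>k\<in>UNIV. ennreal (u $ k - l $ k))"
    using le' by (simp add: emeasure_distr emeasure_PiM)
  also have "\<dots> = ennreal (\<Prod>k\<in>UNIV. u $ k - l $ k)"
    using le' by (simp add: prod_ennreal)
  also have "(\<Prod>k\<in>UNIV. u $ k - l $ k) = (\<Prod>b\<in>Basis. (u - l) \<bullet> b)"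
    \<comment> \<open>The choice term inverts \<open>k \<mapsto> axis k 1\<close>, the bijection
      from indices to basis vectors.\<close>
    by (rule prod.reindex_bij_witness[of _ "\<lambda>b. SOME k. b = axis k 1" "\<lambda>k. axis k 1"])
       (auto simp: Basis_vec_def inner_axis axis_eq_axis)
  finally show "emeasure (distr (\<Pi>\<^sub>M k\<in>UNIV. lborel) borel (\<lambda>x. \<chi> k. x k)) (box l u)
      = ennreal (\<Prod>b\<in>Basis. (u - l) \<bullet> b)" .
qed simp

text \<open>This is the independence of the coordinates. Each \<open>A k\<close> lies in (0,1), so
  the set lies in the cube and its measure is a product measure of a rectangle.\<close>

lemma emeasure_unit_cube_product:
  fixes A :: "'n::finite \<Rightarrow> real set"
  assumes "\<And>k. A k \<in> sets unit_cube"
  shows "emeasure unit_cube {s :: real^'n. \<forall>k. s $ k \<in> A k} = (\<Prod>k\<in>UNIV. emeasure unit_cube (A k))"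
proof -
  interpret product_sigma_finite "\<lambda>k::'n. lborel :: real measure" ..
  have A: "A k \<in> sets borel" "A k \<subseteq> {0<..<1}" for k
    using assms[of k] by (auto simp: sets_unit_cube sets_restrict_space)
  have meas: "(\<lambda>x. \<chi> k. x k) \<in> (\<Pi>\<^sub>M k\<in>UNIV. lborel) \<rightarrow>\<^sub>M (borel :: (real^'n) measure)"
    by (rule measurable_vec_lambda) simp
  have "{s :: real^'n. \<forall>k. s $ k \<in> A k} = (\<Inter>k. (\<lambda>s. s $ k) -` A k \<inter> space borel)"
    by auto
  also have "\<dots> \<in> sets borel"
    using A(1) by (intro sets.finite_INT measurable_sets[where A=borel]) auto
  finally have sets: "{s :: real^'n. \<forall>k. s $ k \<in> A k} \<in> sets borel" .
  have "emeasure unit_cube {s :: real^'n. \<forall>k. s $ k \<in> A k} = emeasure lborel {s :: real^'n. \<forall>k. s $ k \<in> A k}"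
    using A(2) by (intro emeasure_unit_cube) (auto simp: mem_unit_cube_vec subset_eq)
  also have "\<dots> = emeasure (\<Pi>\<^sub>M k\<in>UNIV. lborel) (\<Pi>\<^sub>E k\<in>UNIV. A k)"
    unfolding lborel_vec_eq[symmetric] emeasure_distr[OF meas sets]
    by (rule arg_cong2[where f=emeasure]) (auto simp: space_PiM PiE_iff Pi_iff)
  also have "\<dots> = (\<Prod>k\<in>UNIV. emeasure unit_cube (A k))"
    using A by (simp add: emeasure_PiM emeasure_unit_cube)
  finally show ?thesis .
qed

lemma measurable_product_rv:
  fixes Y :: "'n::finite \<Rightarrow> real \<Rightarrow> real"
  assumes "\<And>k. Y k \<in> borel_measurable unit_cube"
  shows "product_rv Y \<in> borel_measurable unit_cube"
  unfolding product_rv_def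
proof (rule measurable_vec_lambda)
  fix k :: 'n
  \<comment> \<open>The projection must land in the restricted space, since \<open>Y k\<close> is
    measurable only on (0,1).\<close>
  have "(\<lambda>s :: real^'n. s $ k) \<in> unit_cube \<rightarrow>\<^sub>M unit_cube"
    unfolding measurable_unit_cube_eq
    by (subst measurable_cong_sets[OF refl sets_unit_cube], rule measurable_restrict_space3)
       (auto simp: mem_unit_cube_vec)
  then show "(\<lambda>s :: real^'n. Y k (s $ k)) \<in> borel_measurable unit_cube"
    by (rule measurable_compose[OF _ assms])
qed

lemma emeasure_distr_product_rv_box:
  fixes l u :: "real^'n"
  assumes Y: "\<And>k. Y k \<in> borel_measurable unit_cube"
  shows "emeasure (distr unit_cube borel (product_rv Y)) (box l u)
    = (\<Prod>k\<in>UNIV. emeasure (distr unit_cube borel (Y k)) {l $ k<..<u $ k})"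
proof -
  have "product_rv Y -` box l u \<inter> space unit_cube
      = {s. \<forall>k. s $ k \<in> Y k -` {l $ k<..<u $ k} \<inter> space unit_cube}"
    by (auto simp: mem_unit_cube_vec mem_box_cart product_rv_def)
  then have "emeasure (distr unit_cube borel (product_rv Y)) (box l u)
      = emeasure unit_cube {s. \<forall>k. s $ k \<in> Y k -` {l $ k<..<u $ k} \<inter> space unit_cube}"
    using Y by (simp only: emeasure_distr measurable_product_rv borel_open open_box)
  also have "\<dots> = (\<Prod>k\<in>UNIV. emeasure unit_cube (Y k -` {l $ k<..<u $ k} \<inter> space unit_cube))"
    using Y by (intro emeasure_unit_cube_product measurable_sets[of _ _ borel]) auto
  finally show ?thesis
    using Y by (simp add: emeasure_distr)
qed

text \<open>Open boxes are stable under intersection and generate the Borel sets, and on a box the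
  law factors into the marginal laws.\<close>

lemma distr_product_rv_cong:
  fixes Y Z :: "'n::finite \<Rightarrow> real \<Rightarrow> real"
  assumes Y: "\<And>k. Y k \<in> borel_measurable unit_cube"
    and Z: "\<And>k. Z k \<in> borel_measurable unit_cube"
    and eq: "\<And>k. distr unit_cube borel (Y k) = distr unit_cube borel (Z k)"
  shows "distr unit_cube borel (product_rv Y) = distr unit_cube borel (product_rv Z)"
proof (rule measure_eqI_generator_eq)
  let ?E = "range (\<lambda>(a, b). box a b :: (real^'n) set)"
  show "Int_stable ?E"
    by (auto simp: Int_stable_def box_Int_box)
  show "?E \<subseteq> Pow UNIV" "sets (distr unit_cube borel (product_rv Y)) = sigma_sets UNIV ?E"
    "sets (distr unit_cube borel (product_rv Z)) = sigma_sets UNIV ?E"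
    by (simp_all add: borel_eq_box)
  let ?A = "\<lambda>n::nat. box (- (real n *\<^sub>R One)) (real n *\<^sub>R One) :: (real^'n) set"
  show "range ?A \<subseteq> ?E" "(\<Union>i. ?A i) = UNIV"
    unfolding UN_box_eq_UNIV by auto
  interpret D: prob_space "distr unit_cube borel (product_rv Y)"
    by (intro cube.prob_space_distr measurable_product_rv Y)
  show "emeasure (distr unit_cube borel (product_rv Y)) (?A i) \<noteq> \<infinity>" for i
    by simp
  show "emeasure (distr unit_cube borel (product_rv Y)) B = emeasure (distr unit_cube borel (product_rv Z)) B"
    if "B \<in> ?E" for B
    using that by (auto simp: emeasure_distr_product_rv_box Y Z eq)
qed

section \<open>Quantile transforms of tail functions\<close>

lemma neat_measurable: "X \<in> neat \<Longrightarrow> X \<in> borel_measurable unit_cube"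
  by (simp add: neat_def measurable_unit_cube_eq borel_measurable_mono_on_fnc)

lemma tail_boundsD:
  assumes "f \<in> tail_bounds"
  shows "f 0 = 1" "\<And>t. 0 \<le> t \<Longrightarrow> 0 \<le> f t" "\<And>t. 0 \<le> t \<Longrightarrow> f t \<le> 1"
    "\<And>t u. 0 \<le> t \<Longrightarrow> t \<le> u \<Longrightarrow> f u \<le> f t" "(f \<longlongrightarrow> 0) at_top"
    "\<And>t. 0 < t \<Longrightarrow> (f \<longlongrightarrow> f t) (at_left t)"
  using assms by (auto simp: tail_bounds_def Pi_iff monotone_on_def continuous_within)

text \<open>The limit 0 at infinity pushes f below 1 - s eventually, so the supremum in
  \<open>extremal_rv\<close> is a genuine one.\<close>

lemma bdd_above_tail_level:
  assumes f: "f \<in> tail_bounds" and s: "s < 1"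
  shows "bdd_above (f -` {1 - s..1} \<inter> {0..})"
proof -
  have "eventually (\<lambda>t. f t < 1 - s) at_top"
    using tail_boundsD(5)[OF f] s by (intro order_tendstoD) auto
  then obtain b where "\<And>t. t \<ge> b \<Longrightarrow> f t < 1 - s"
    by (auto simp: eventually_at_top_linorder)
  then show ?thesis
    by (intro bdd_aboveI[of _ b]) (auto simp: not_less[symmetric] intro: leI dest: less_imp_le)
qed

text \<open>Left continuity makes the level set closed under increasing limits, so it is the whole
  interval from 0 to its supremum. The later facts about \<open>extremal_rv\<close> rest on this
  Galois-type equivalence.\<close>

lemma le_extremal_rv_iff:
  assumes f: "f \<in> tail_bounds" and s: "0 < s" "s < 1" and u: "0 \<le> u"
  shows "u \<le> extremal_rv f s \<longleftrightarrow> 1 - s \<le> f u"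
proof
  note fD = tail_boundsD[OF f]
  assume le: "u \<le> extremal_rv f s"
  show "1 - s \<le> f u"
  proof (cases "u = 0")
    case False
    with u have "0 < u" by simp
    \<comment> \<open>Below the supremum the level set still has a point w > v, and f decreases from
      v to w. Letting v tend to u from the left then gives the bound at u itself.\<close>
    have "1 - s \<le> f v" if "v \<in> {0<..<u}" for v
    proof -
      have "v < Sup (f -` {1 - s..1} \<inter> {0..})"
        using that le by (simp add: extremal_rv_def)
      moreover have "0 \<in> f -` {1 - s..1} \<inter> {0..}"
        using fD(1) s by simp
      ultimately obtain w where "v < w" "1 - s \<le> f w"
        by (subst (asm) less_cSup_iff) (auto intro: bdd_above_tail_level f s)
      then show ?thesis using fD(4)[of v w] that by simp
    qed
    moreover have "eventually (\<lambda>v. v \<in> {0<..<u}) (at_left u)"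
      using \<open>0 < u\<close> by (rule eventually_at_leftI[rotated]) simp
    ultimately have "eventually (\<lambda>v. 1 - s \<le> f v) (at_left u)"
      by (auto elim: eventually_mono)
    then show ?thesis
      using fD(6)[OF \<open>0 < u\<close>] by (intro tendsto_lowerbound) auto
  qed (use fD(1) s in simp)
next
  assume "1 - s \<le> f u"
  then show "u \<le> extremal_rv f s"
    unfolding extremal_rv_def using tail_boundsD(3)[OF f u] u
    by (intro cSup_upper bdd_above_tail_level f s) simp
qed

lemma extremal_rv_nonneg:
  "f \<in> tail_bounds \<Longrightarrow> 0 < s \<Longrightarrow> s < 1 \<Longrightarrow> 0 \<le> extremal_rv f s"
  by (simp add: le_extremal_rv_iff tail_boundsD(1))

lemma extremal_rv_neat:
  assumes f: "f \<in> tail_bounds"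
  shows "extremal_rv f \<in> neat"
proof -
  have "extremal_rv f r \<le> extremal_rv f s" if "0 < r" "r \<le> s" "s < 1" for r s
  proof -
    \<comment> \<open>The equivalence is used at u = \<open>extremal_rv f r\<close>: the supremum
      belongs to its own level set.\<close>
    have "1 - r \<le> f (extremal_rv f r)"
      using that by (subst le_extremal_rv_iff[OF f, symmetric]) (auto intro: extremal_rv_nonneg f)
    with that show ?thesis
      by (subst le_extremal_rv_iff[OF f]) (auto intro: extremal_rv_nonneg f)
  qed
  then show ?thesis by (auto simp: neat_def intro!: mono_onI)
qed

lemma extremal_rv_mono:
  assumes h: "h \<in> tail_bounds" and f: "f \<in> tail_bounds" and s: "0 < s" "s < 1"
    and le: "\<And>t. 0 \<le> t \<Longrightarrow> h t \<le> f t"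
  shows "extremal_rv h s \<le> extremal_rv f s"
proof -
  have "1 - s \<le> h (extremal_rv h s)"
    by (subst le_extremal_rv_iff[OF h s, symmetric]) (auto intro: extremal_rv_nonneg h s)
  also have "\<dots> \<le> f (extremal_rv h s)"
    by (rule le[OF extremal_rv_nonneg[OF h s]])
  finally show ?thesis
    by (subst le_extremal_rv_iff[OF f s]) (auto intro: extremal_rv_nonneg h s)
qed

lemma measure_extremal_rv_ge:
  assumes f: "f \<in> tail_bounds" and u: "0 \<le> u"
  shows "measure unit_cube {s \<in> space unit_cube. u \<le> extremal_rv f s} = f u"
proof -
  have "{s \<in> space unit_cube. u \<le> extremal_rv f s} = {s \<in> {0<..<1}. 1 - f u \<le> s}"
    using le_extremal_rv_iff[OF f _ _ u] by auto
  \<comment> \<open>If f u = 1, the left endpoint 1 - f u is 0, which lies outside (0,1). Both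
    intervals have length f u.\<close>
  also have "\<dots> = (if f u = 1 then {0<..<1} else {1 - f u..<1})"
    using tail_boundsD(2,3)[OF f u] by auto
  finally have *: "{s \<in> space unit_cube. u \<le> extremal_rv f s} = \<dots>" .
  have "emeasure unit_cube {s \<in> space unit_cube. u \<le> extremal_rv f s}
      = emeasure lborel {s \<in> space unit_cube. u \<le> extremal_rv f s}"
    by (rule emeasure_unit_cube) auto
  also have "\<dots> = ennreal (f u)"
    unfolding * using tail_boundsD(2)[OF f u] by simp
  finally show ?thesis
    using tail_boundsD(2)[OF f u] by (simp add: measure_def)
qed

section \<open>Tail functions of nonnegative random variables\<close>

definition tail_fn :: "(real \<Rightarrow> real) \<Rightarrow> real \<Rightarrow> real" where
  "tail_fn Y t = measure unit_cube {s \<in> space unit_cube. t \<le> Y s}"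

text \<open>Reflection turns the closed tail event into a lower half-line, which makes the theory of
  distribution functions available.\<close>

lemma tail_fn_eq_cdf:
  assumes Y: "Y \<in> borel_measurable unit_cube"
  shows "tail_fn Y t = cdf (distr unit_cube borel (\<lambda>s. - Y s)) (- t)"
  using Y by (auto simp: tail_fn_def cdf_def measure_distr simp del: space_unit_cube
      intro!: arg_cong[where f="measure unit_cube"])

lemma tail_fn_nonpos:
  assumes nonneg: "\<And>s. s \<in> {0<..<1} \<Longrightarrow> 0 \<le> Y s" and t: "t \<le> 0"
  shows "tail_fn Y t = 1"
proof -
  have "{s \<in> space unit_cube. t \<le> Y s} = space unit_cube"
    using nonneg t by force
  then show ?thesis
    unfolding tail_fn_def by (simp only: cube.prob_space)
qed

lemma tail_fn_tail_bounds:
  assumes Y: "Y \<in> borel_measurable unit_cube" and nonneg: "\<And>s. s \<in> {0<..<1} \<Longrightarrow> 0 \<le> Y s"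
  shows "tail_fn Y \<in> tail_bounds"
proof -
  define D where "D = distr unit_cube borel (\<lambda>s. - Y s)"
  interpret D: real_distribution D
    unfolding D_def using Y by (intro cube.real_distribution_distr) simp
  have h: "tail_fn Y = (\<lambda>t. cdf D (- t))"
    using tail_fn_eq_cdf[OF Y] by (auto simp: D_def)
  \<comment> \<open>Negation swaps left and right neighbourhoods, so right continuity of the cdf
    becomes left continuity of the tail.\<close>
  have "((\<lambda>t. cdf D (- t)) \<longlongrightarrow> cdf D (- t)) (at_left t)" for t
    using D.cdf_is_right_cont[of "- t"]
    unfolding continuous_within by (subst at_left_minus) (simp add: filterlim_filtermap)
  moreover have "((\<lambda>t. cdf D (- t)) \<longlongrightarrow> 0) at_top"
    by (rule filterlim_compose[OF D.cdf_lim_at_bot filterlim_uminus_at_bot_at_top])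
  moreover have "tail_fn Y 0 = 1"
    using nonneg by (intro tail_fn_nonpos) auto
  ultimately show ?thesis
    by (auto simp: tail_bounds_def h continuous_within D.cdf_nonneg D.cdf_bounded_prob
        intro!: D.cdf_nondecreasing monotone_onI)
qed

text \<open>The tails agree for t \<ge> 0 by \<open>measure_extremal_rv_ge\<close>, and for t < 0
  both equal 1 by nonnegativity. Hence the reflected variables have the same cdf and thus the same
  law; reflecting back gives the claim.\<close>

lemma distr_extremal_rv_tail_fn:
  assumes Y: "Y \<in> borel_measurable unit_cube" and nonneg: "\<And>s. s \<in> {0<..<1} \<Longrightarrow> 0 \<le> Y s"
  shows "distr unit_cube borel (extremal_rv (tail_fn Y)) = distr unit_cube borel Y"
proof -
  let ?Z = "extremal_rv (tail_fn Y)"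
  have h: "tail_fn Y \<in> tail_bounds" by (rule tail_fn_tail_bounds[OF assms])
  have Z: "?Z \<in> borel_measurable unit_cube" by (intro neat_measurable extremal_rv_neat h)
  have "tail_fn ?Z t = tail_fn Y t" for t
  proof (cases "0 \<le> t")
    case True
    then show ?thesis
      using measure_extremal_rv_ge[OF h True] by (simp add: tail_fn_def[of ?Z])
  next
    case False
    then show ?thesis
      using tail_fn_nonpos[of Y t] tail_fn_nonpos[of ?Z t] nonneg extremal_rv_nonneg[OF h] by simp
  qed
  then have "cdf (distr unit_cube borel (\<lambda>s. - ?Z s)) t = cdf (distr unit_cube borel (\<lambda>s. - Y s)) t" for t
    using tail_fn_eq_cdf[OF Y, of "- t"] tail_fn_eq_cdf[OF Z, of "- t"] by simp
  then have "distr unit_cube borel (\<lambda>s. - ?Z s) = distr unit_cube borel (\<lambda>s. - Y s)"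
    using Y Z by (intro cdf_unique cube.real_distribution_distr ext) auto
  then have "distr (distr unit_cube borel (\<lambda>s. - ?Z s)) borel uminus
      = distr (distr unit_cube borel (\<lambda>s. - Y s)) borel uminus"
    by simp
  then show ?thesis
    using Y Z by (simp add: distr_distr comp_def)
qed

theorem theorem2p3p1:
  fixes g :: "real^'n::finite \<Rightarrow> real"
    and f :: "'n \<Rightarrow> real \<Rightarrow> real"
    and t :: real
  assumes "g \<in> borel_measurable borel"
    and "\<And>x y. (\<And>i. 0 \<le> x $ i \<and> x $ i \<le> y $ i) \<Longrightarrow> g x \<le> g y"
    and "\<And>x. g x \<le> g (\<chi> i. \<bar>x $ i\<bar>)"
    and "\<And>k. f k \<in> tail_bounds"
  shows "(SUP X\<in>tail_bounded f. measure unit_cube {s \<in> space unit_cube. g (X s) \<ge> t}) =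
    measure unit_cube {s \<in> space unit_cube. g (product_rv (\<lambda>k. extremal_rv (f k)) s) \<ge> t}"
proof (rule cSup_eq_maximum)
  let ?E = "\<lambda>k. extremal_rv (f k)"
  note mono = assms(2) and f = assms(4)
  have meas: "{s \<in> space unit_cube. t \<le> g (product_rv Y s)} \<in> sets unit_cube"
    if "\<And>k. Y k \<in> borel_measurable unit_cube" for Y
    using measurable_compose[OF measurable_product_rv[OF that] assms(1)] by measurable
  have pos: "s $ k \<in> {0<..<1}" if "s \<in> space unit_cube" for s :: "real^'n" and k
    using that by (simp add: mem_unit_cube_vec)
  \<comment> \<open>Attainment: \<open>?E k\<close> is nonnegative, so its absolute tail is its
    tail, which is exactly \<open>f k\<close>.\<close>
  have "{s \<in> space unit_cube. u \<le> \<bar>?E k s\<bar>} = {s \<in> space unit_cube. u \<le> ?E k s}" for k u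
    using extremal_rv_nonneg[OF f] by auto
  then have "product_rv ?E \<in> tail_bounded f"
    unfolding tail_bounded_def using measure_extremal_rv_ge[OF f] extremal_rv_neat[OF f] by auto
  then show "measure unit_cube {s \<in> space unit_cube. g (product_rv ?E s) \<ge> t}
      \<in> (\<lambda>X. measure unit_cube {s \<in> space unit_cube. g (X s) \<ge> t}) ` tail_bounded f"
    by blast
  fix p assume "p \<in> (\<lambda>X. measure unit_cube {s \<in> space unit_cube. g (X s) \<ge> t}) ` tail_bounded f"
  then obtain X where p: "p = measure unit_cube {s \<in> space unit_cube. g (product_rv X s) \<ge> t}"
    and neat: "\<And>k. X k \<in> neat"
    and tail: "\<And>k u. 0 \<le> u \<Longrightarrow> measure unit_cube {s \<in> space unit_cube. \<bar>X k s\<bar> \<ge> u} \<le> f k u"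
    by (auto simp: tail_bounded_def)
  \<comment> \<open>The absolute value of an increasing function need not be increasing, and
    \<open>Y\<close> need not lie pointwise below \<open>?E\<close>. \<open>Z\<close> is its
    increasing rearrangement, which does.\<close>
  define Y where "Y k s = \<bar>X k s\<bar>" for k s
  define Z where "Z k = extremal_rv (tail_fn (Y k))" for k
  have Y: "Y k \<in> borel_measurable unit_cube" for k
    unfolding Y_def using neat_measurable[OF neat] by simp
  have h: "tail_fn (Y k) \<in> tail_bounds" for k
    by (rule tail_fn_tail_bounds[OF Y]) (simp add: Y_def)
  have Z: "Z k \<in> borel_measurable unit_cube" for k
    unfolding Z_def by (intro neat_measurable extremal_rv_neat h)
  have E: "?E k \<in> borel_measurable unit_cube" for k
    by (intro neat_measurable extremal_rv_neat f)
  have ZE: "0 \<le> Z k r \<and> Z k r \<le> ?E k r" if "r \<in> {0<..<1}" for k r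
    unfolding Z_def using that tail
    by (auto intro!: extremal_rv_nonneg extremal_rv_mono h f simp: tail_fn_def Y_def)
  have "p \<le> measure unit_cube {s \<in> space unit_cube. t \<le> g (product_rv Y s)}"
    unfolding p
  proof (rule cube.finite_measure_mono[OF _ meas[OF Y]], rule Collect_mono, rule impI)
    fix s assume "s \<in> space unit_cube \<and> t \<le> g (product_rv X s)"
    then show "s \<in> space unit_cube \<and> t \<le> g (product_rv Y s)"
      using assms(3)[of "product_rv X s"] by (auto simp: product_rv_def Y_def)
  qed
  also have "\<dots> = measure (distr unit_cube borel (product_rv Y)) {x. t \<le> g x}"
    using assms(1) by (subst measure_distr[OF measurable_product_rv[OF Y]])
      (auto intro!: arg_cong[where f="measure unit_cube"])
  \<comment> \<open>Only the law of the vector matters here, so each component may be rearranged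
    separately.\<close>
  also have "distr unit_cube borel (product_rv Y) = distr unit_cube borel (product_rv Z)"
    by (rule distr_product_rv_cong[OF Y Z])
       (auto simp: Z_def Y_def intro!: distr_extremal_rv_tail_fn[symmetric] Y)
  also have "measure (distr unit_cube borel (product_rv Z)) {x. t \<le> g x}
      = measure unit_cube {s \<in> space unit_cube. t \<le> g (product_rv Z s)}"
    using assms(1) by (subst measure_distr[OF measurable_product_rv[OF Z]])
      (auto intro!: arg_cong[where f="measure unit_cube"])
  also have "\<dots> \<le> measure unit_cube {s \<in> space unit_cube. t \<le> g (product_rv ?E s)}"
  proof (rule cube.finite_measure_mono[OF _ meas[OF E]], rule Collect_mono, rule impI)
    \<comment> \<open>Monotonicity of g is assumed on the nonnegative orthant, hence the lower bound
      0 in \<open>ZE\<close>.\<close>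
    fix s assume s: "s \<in> space unit_cube \<and> t \<le> g (product_rv Z s)"
    then have "g (product_rv Z s) \<le> g (product_rv ?E s)"
      using ZE pos by (intro mono) (auto simp: product_rv_def)
    with s show "s \<in> space unit_cube \<and> t \<le> g (product_rv ?E s)" by auto
  qed
  finally show "p \<le> measure unit_cube {s \<in> space unit_cube. g (product_rv ?E s) \<ge> t}" .
qed

end
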